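(* $\mathcal{P}(2^{51},52)\neq\varnothing$; that is, there is a polynomial $f(x)=\sum_{i=0}^{2^{51}-1}a_ix^i$ with all $a_i\in\{1,-1\}$ that is divisible by $(x-1)^{52}$.
   Context: $\mathcal{P}(n,m)$ denotes the set of polynomials $\sum_{i=0}^{n-1}a_ix^i$ with all $a_i\in\{1,-1\}$ (Littlewood polynomials of length $n$) that are divisible by $(x-1)^m$. *)

theory Defs
  imports "HOL-Computational_Algebra.Polynomial"
begin

text \<open>
  Littlewood polynomials of length \<open>n\<close> (all coefficients of \<open>x\<^sup>0, \<dots>, x\<^sup>n\<^sup>-\<^sup>1\<close> are \<open>1\<close> or
  \<open>-1\<close>) divisible by \<open>(x - 1)\<^sup>m\<close>. Polynomials and divisibility are taken over the integers;
  since \<open>(x - 1)\<^sup>m\<close> is monic, divisibility over the rationals or reals is the same.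
\<close>

definition littlewood_polys :: "nat \<Rightarrow> nat \<Rightarrow> int poly set" where
  "littlewood_polys n m =
     {f. (\<exists>a :: nat \<Rightarrow> int. (\<forall>i<n. a i \<in> {1, -1}) \<and> f = (\<Sum>i<n. monom (a i) i)) \<and>
         [:-1, 1:] ^ m dvd f}"

end

theory Submission
  imports Defs
begin

text \<open>
  Write \<open>n \<in> S\<^sub>m\<close> if there is a Littlewood polynomial of length \<open>n\<close> divisible by
  \<open>(x - 1)\<^sup>m\<close>. Then \<open>2 \<in> S\<^sub>1\<close>, each \<open>S\<^sub>m\<close> is closed under addition (concatenation), and
  \<open>n \<in> S\<^sub>m\<close>, \<open>k \<in> S\<^sub>l\<close> imply \<open>n k \<in> S\<^sub>m\<^sub>+\<^sub>l\<close> (take \<open>f(x) g(x\<^sup>n)\<close>). A computer search found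
  polynomials, palindromic or (for 192) antipalindromic, showing \<open>48 \<in> S\<^sub>6\<close>,
  \<open>144, 208, 224, 272 \<in> S\<^sub>8\<close> and \<open>192 \<in> S\<^sub>9\<close>. The products of order 52 formed from these
  that add up to \<open>2\<^sup>5\<^sup>1\<close> were found by dynamic programming. Lengths divisible by 3 do not
  suffice, and the others are expensive: if 3 does not divide the length, then the value
  of the polynomial at a primitive cube root of unity is nonzero and divisible by
  \<open>(1 - \<omega>)\<^sup>m\<close>.
\<close>

section \<open>Closure of the lengths under sums and products\<close>

lemma littlewood_polys_nonempty_iff:
  "littlewood_polys n m \<noteq> {} \<longleftrightarrow>
     (\<exists>a :: nat \<Rightarrow> int. (\<forall>i<n. a i \<in> {1, -1}) \<and> [:-1, 1:] ^ m dvd (\<Sum>i<n. monom (a i) i))"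
  unfolding littlewood_polys_def by blast

lemma sum_lessThan_add:
  fixes f :: "nat \<Rightarrow> 'a :: comm_monoid_add"
  shows "(\<Sum>i<n + k. f i) = (\<Sum>i<n. f i) + (\<Sum>i<k. f (n + i))"
  by (induction k) (simp_all add: add.assoc)

lemma sum_lessThan_mult:
  fixes f :: "nat \<Rightarrow> 'a :: comm_monoid_add"
  shows "(\<Sum>i<n * k. f i) = (\<Sum>j<k. \<Sum>i<n. f (n * j + i))"
  by (induction k) (simp_all add: sum_lessThan_add add.commute[of n])

lemma littlewood_polys_add:
  assumes "littlewood_polys n m \<noteq> {}" and "littlewood_polys k m \<noteq> {}"
  shows "littlewood_polys (n + k) m \<noteq> {}"
proof -
  obtain a :: "nat \<Rightarrow> int" where a: "\<forall>i<n. a i \<in> {1, -1}" "[:-1, 1:] ^ m dvd (\<Sum>i<n. monom (a i) i)"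
    using assms(1) unfolding littlewood_polys_nonempty_iff by blast
  obtain b :: "nat \<Rightarrow> int" where b: "\<forall>i<k. b i \<in> {1, -1}" "[:-1, 1:] ^ m dvd (\<Sum>i<k. monom (b i) i)"
    using assms(2) unfolding littlewood_polys_nonempty_iff by blast
  define c where "c i = (if i < n then a i else b (i - n))" for i
  have "(\<Sum>i<n + k. monom (c i) i) = (\<Sum>i<n. monom (c i) i) + (\<Sum>i<k. monom (c (n + i)) (n + i))"
    by (rule sum_lessThan_add)
  also have "(\<Sum>i<n. monom (c i) i) = (\<Sum>i<n. monom (a i) i)"
    by (intro sum.cong refl) (simp add: c_def)
  also have "(\<Sum>i<k. monom (c (n + i)) (n + i)) = monom 1 n * (\<Sum>i<k. monom (b i) i)"
    unfolding sum_distrib_left by (intro sum.cong refl) (simp add: c_def mult_monom)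
  finally have "[:-1, 1:] ^ m dvd (\<Sum>i<n + k. monom (c i) i)"
    using a(2) b(2) by (simp only: dvd_add dvd_mult)
  moreover have "\<forall>i<n + k. c i \<in> {1, -1}"
    using a(1) b(1) by (auto simp: c_def)
  ultimately show ?thesis
    unfolding littlewood_polys_nonempty_iff by blast
qed

lemma pcompose_power: "pcompose (p ^ k) q = pcompose p q ^ k"
  by (induction k) (simp_all add: pcompose_mult pcompose_1)

lemma pcompose_monom: "pcompose (monom a i) q = smult a (q ^ i)"
  by (induction i) (simp_all add: monom_0 monom_Suc pcompose_pCons)

text \<open>Substituting \<open>x^n\<close> for x turns the factor \<open>(x - 1)^l\<close> into
  \<open>(x^n - 1)^l\<close>, and x - 1 divides \<open>x^n - 1\<close> because 1 is a root.\<close>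

lemma X_minus_1_power_dvd_pcompose_monom:
  fixes g :: "int poly"
  assumes "[:-1, 1:] ^ l dvd g"
  shows "[:-1, 1:] ^ l dvd pcompose g (monom 1 n)"
proof -
  obtain h where "g = [:-1, 1:] ^ l * h" using assms by (elim dvdE)
  moreover have "pcompose [:-1, 1:] (monom 1 n) = (monom 1 n - 1 :: int poly)"
    by (simp add: pcompose_pCons one_pCons)
  ultimately have "pcompose g (monom 1 n) = (monom 1 n - 1) ^ l * pcompose h (monom 1 n)"
    by (simp only: pcompose_mult pcompose_power)
  moreover have "[:-1, 1:] dvd (monom 1 n - 1 :: int poly)"
    using poly_eq_0_iff_dvd[of "monom 1 n - 1 :: int poly" 1] by (simp add: poly_monom)
  ultimately show ?thesis by (simp add: dvd_power_same)
qed

lemma littlewood_polys_mult: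
  assumes "littlewood_polys n m \<noteq> {}" and "littlewood_polys k l \<noteq> {}"
  shows "littlewood_polys (n * k) (m + l) \<noteq> {}"
proof -
  obtain a :: "nat \<Rightarrow> int" where a: "\<forall>i<n. a i \<in> {1, -1}" "[:-1, 1:] ^ m dvd (\<Sum>i<n. monom (a i) i)"
    using assms(1) unfolding littlewood_polys_nonempty_iff by blast
  obtain b :: "nat \<Rightarrow> int" where b: "\<forall>i<k. b i \<in> {1, -1}" "[:-1, 1:] ^ l dvd (\<Sum>i<k. monom (b i) i)"
    using assms(2) unfolding littlewood_polys_nonempty_iff by blast
  \<comment> \<open>Each exponent below n k is r + n j for a single pair r < n, j < k, so no terms
    of f(x) g(\<open>x^n\<close>) collide and its coefficients stay 1 or -1.\<close>
  define c where "c i = a (i mod n) * b (i div n)" for i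
  have "(\<Sum>i<n * k. monom (c i) i) = (\<Sum>j<k. \<Sum>i<n. monom (c (n * j + i)) (n * j + i))"
    by (rule sum_lessThan_mult)
  also have "\<dots> = (\<Sum>j<k. \<Sum>i<n. monom (a i) i * monom (b j) (n * j))"
    by (intro sum.cong refl) (simp add: c_def mult_monom add.commute)
  also have "\<dots> = (\<Sum>i<n. monom (a i) i) * (\<Sum>j<k. monom (b j) (n * j))"
    by (simp add: sum_product sum.swap[of _ "{..<n}"])
  also have "(\<Sum>j<k. monom (b j) (n * j)) = pcompose (\<Sum>j<k. monom (b j) j) (monom 1 n)"
    by (simp add: pcompose_sum pcompose_monom monom_power smult_monom mult.commute)
  finally have "[:-1, 1:] ^ (m + l) dvd (\<Sum>i<n * k. monom (c i) i)"
    using a(2) X_minus_1_power_dvd_pcompose_monom[OF b(2), of n]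
    by (simp add: power_add mult_dvd_mono)
  moreover have "\<forall>i<n * k. c i \<in> {1, -1}"
  proof (intro allI impI)
    fix i assume "i < n * k"
    then have "i mod n < n" "i div n < k"
      by (auto simp: less_mult_imp_div_less mult.commute intro!: mod_less_divisor gr0I)
    then show "c i \<in> {1, -1}"
      using a(1) b(1) by (fastforce simp: c_def)
  qed
  ultimately show ?thesis
    unfolding littlewood_polys_nonempty_iff by blast
qed

lemma littlewood_polys_power:
  assumes "littlewood_polys n m \<noteq> {}"
  shows "littlewood_polys (n ^ k) (k * m) \<noteq> {}"
proof (induction k)
  case 0
  show ?case
    unfolding littlewood_polys_nonempty_iff by (auto intro: exI[of _ "\<lambda>_. 1"])
next
  case (Suc k)
  then show ?case using littlewood_polys_mult[OF assms] by simp
qed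

section \<open>Certifying the order of vanishing at 1\<close>

primrec partial_sums :: "int \<Rightarrow> int list \<Rightarrow> int list" where
  "partial_sums s [] = []"
| "partial_sums s (x # xs) = (s + x) # partial_sums (s + x) xs"

text \<open>Multiplying by 1 - x takes differences of consecutive partial sums, which gives back the
  entries of \<open>xs\<close>; only the boundary terms, start value and final sum, remain. When
  both are 0, the division by 1 - x is exact.\<close>

lemma Poly_partial_sums:
  "[:1, -1:] * Poly (partial_sums s xs) = Poly xs + [:s:] - monom (s + sum_list xs) (length xs)"
proof (induction xs arbitrary: s)
  case (Cons x xs)
  have "[:1, -1:] * Poly (partial_sums s (x # xs)) =
      [:s + x, - (s + x):] + pCons 0 ([:1, -1:] * Poly (partial_sums (s + x) xs))"
    by simp
  also have "\<dots> = Poly (x # xs) + [:s:] - monom (s + sum_list (x # xs)) (length (x # xs))"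
    unfolding Cons.IH by (simp add: monom_Suc algebra_simps)
  finally show ?case .
qed (simp add: monom_0)

text \<open>An executable test by repeated synthetic division: \<open>sum_list xs\<close> is the
  value of \<open>Poly xs\<close> at 1, and once it is 0 the partial sums are the coefficients of
  the quotient by 1 - x, up to a trailing 0 that \<open>Poly\<close> ignores.\<close>

primrec vanishing_order_ge :: "nat \<Rightarrow> int list \<Rightarrow> bool" where
  "vanishing_order_ge 0 xs = True"
| "vanishing_order_ge (Suc m) xs \<longleftrightarrow> sum_list xs = 0 \<and> vanishing_order_ge m (partial_sums 0 xs)"

lemma X_minus_1_power_dvd_Poly:
  "vanishing_order_ge m xs \<Longrightarrow> [:-1, 1:] ^ m dvd Poly xs"
proof (induction m arbitrary: xs)
  case (Suc m)
  then have "Poly xs = [:1, -1:] * Poly (partial_sums 0 xs)"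
    by (simp only: Poly_partial_sums) simp
  also have "\<dots> = [:-1, 1:] * (- Poly (partial_sums 0 xs))"
    by simp
  finally have "Poly xs = [:-1, 1:] * (- Poly (partial_sums 0 xs))" .
  moreover have "[:-1, 1:] ^ m dvd - Poly (partial_sums 0 xs)"
    using Suc by simp
  ultimately show ?case
    by (simp only: power_Suc mult_dvd_mono dvd_refl)
qed simp

lemma Poly_eq_sum_monom: "Poly xs = (\<Sum>i<length xs. monom (xs ! i) i)"
  by (rule poly_eqI) (simp add: coeff_Poly_eq nth_default_def coeff_sum)

lemma littlewood_polys_list:
  assumes "vanishing_order_ge m xs" and "set xs \<subseteq> {1, -1}"
  shows "littlewood_polys (length xs) m \<noteq> {}"
  unfolding littlewood_polys_nonempty_iff
  using X_minus_1_power_dvd_Poly[OF assms(1)] assms(2)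
  by (intro exI[of _ "\<lambda>i. xs ! i"]) (auto simp flip: Poly_eq_sum_monom dest: nth_mem)

primrec sign_runs :: "int \<Rightarrow> nat list \<Rightarrow> int list" where
  "sign_runs s [] = []"
| "sign_runs s (k # ks) = replicate k s @ sign_runs (- s) ks"

text \<open>
  As the signs alternate from run to run, run lengths \<open>rev ks @ k # ks\<close> give palindromes and
  \<open>rev ks @ ks\<close> antipalindromes.
\<close>

lemma set_sign_runs: "set (sign_runs s ks) \<subseteq> {s, -s}"
  by (induction ks arbitrary: s) fastforce+

lemma length_sign_runs: "length (sign_runs s ks) = sum_list ks"
  by (induction ks arbitrary: s) auto

lemma littlewood_polys_sign_runs:
  assumes "vanishing_order_ge m (sign_runs 1 ks)"
  shows "littlewood_polys (sum_list ks) m \<noteq> {}"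
  using littlewood_polys_list[OF assms] set_sign_runs[of 1 ks] by (simp add: length_sign_runs)

section \<open>Explicit polynomials of small length\<close>

lemma littlewood_polys_2_1: "littlewood_polys 2 1 \<noteq> {}"
  using littlewood_polys_list[of 1 "[1, -1]"] by (simp add: numeral_2_eq_2)

text \<open>Replacing x by 1/x shows that the exact order at 1 is even for a palindrome and odd for
  an antipalindrome. So symmetry lifts order 5 to 6 and 7 to 8 for palindromes, and 8 to 9 for
  antipalindromes.\<close>

lemma littlewood_polys_48_6: "littlewood_polys 48 6 \<noteq> {}"
proof -
  define ks :: "nat list" where "ks =
     [2, 3, 2, 1, 5, 2, 1, 4, 2]"
  have "vanishing_order_ge 6 (sign_runs 1 (rev ks @ 4 # ks))"
    unfolding ks_def by code_simp
  from littlewood_polys_sign_runs[OF this] show ?thesis by (simp add: ks_def)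
qed

lemma littlewood_polys_144_8: "littlewood_polys 144 8 \<noteq> {}"
proof -
  define ks :: "nat list" where "ks =
     [1, 3, 1, 1, 3, 1, 2, 2, 1, 1, 3, 2, 1, 1, 2, 5, 3, 2, 2, 1, 4, 1, 1, 2, 1,
      2, 1, 1, 1, 3, 2, 3, 3, 1, 3, 2, 1, 1]"
  have "vanishing_order_ge 8 (sign_runs 1 (rev ks @ 2 # ks))"
    unfolding ks_def by code_simp
  from littlewood_polys_sign_runs[OF this] show ?thesis by (simp add: ks_def)
qed

lemma littlewood_polys_192_9: "littlewood_polys 192 9 \<noteq> {}"
proof -
  define ks :: "nat list" where "ks =
     [1, 1, 2, 1, 6, 4, 2, 1, 1, 1, 2, 1, 1, 1, 2, 1, 1, 1, 1, 4, 1, 2, 1, 2, 5,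
      5, 3, 1, 2, 1, 1, 1, 1, 4, 3, 1, 5, 3, 1, 2, 1, 4, 3, 2, 4, 2]"
  have "vanishing_order_ge 9 (sign_runs 1 (rev ks @ ks))"
    unfolding ks_def by code_simp
  from littlewood_polys_sign_runs[OF this] show ?thesis by (simp add: ks_def)
qed

lemma littlewood_polys_208_8: "littlewood_polys 208 8 \<noteq> {}"
proof -
  define ks :: "nat list" where "ks =
     [1, 1, 3, 1, 2, 1, 1, 1, 2, 2, 1, 2, 1, 1, 3, 1, 1, 1, 2, 5, 1, 2, 1, 2, 1,
      2, 1, 2, 1, 1, 2, 2, 2, 1, 2, 1, 1, 2, 4, 2, 1, 2, 5, 1, 2, 3, 2, 2, 1, 2,
      1, 2, 1, 1, 1, 2, 3, 3, 2]"
  have "vanishing_order_ge 8 (sign_runs 1 (rev ks @ 2 # ks))"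
    unfolding ks_def by code_simp
  from littlewood_polys_sign_runs[OF this] show ?thesis by (simp add: ks_def)
qed

lemma littlewood_polys_224_8: "littlewood_polys 224 8 \<noteq> {}"
proof -
  define ks :: "nat list" where "ks =
     [5, 1, 1, 2, 1, 2, 1, 2, 1, 2, 1, 2, 1, 1, 2, 1, 2, 2, 2, 1, 1, 2, 1, 2, 2,
      1, 1, 2, 2, 1, 2, 1, 1, 2, 4, 2, 2, 1, 1, 2, 1, 6, 1, 1, 2, 1, 2, 1, 2, 1,
      1, 1, 3, 1, 1, 1, 1, 2, 2, 2, 3, 6, 3]"
  have "vanishing_order_ge 8 (sign_runs 1 (rev ks @ 2 # ks))"
    unfolding ks_def by code_simp
  from littlewood_polys_sign_runs[OF this] show ?thesis by (simp add: ks_def)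
qed

lemma littlewood_polys_272_8: "littlewood_polys 272 8 \<noteq> {}"
proof -
  define ks :: "nat list" where "ks =
     [3, 2, 2, 2, 1, 1, 2, 2, 1, 2, 1, 2, 2, 2, 1, 4, 4, 1, 2, 2, 2, 1, 1, 1, 3,
      4, 4, 5, 1, 1, 5, 1, 3, 1, 2, 1, 1, 2, 1, 2, 1, 4, 2, 2, 1, 2, 4, 5, 1, 2,
      1, 1, 1, 1, 4, 1, 1, 1, 2, 2, 4, 2, 1, 1, 1, 3, 1, 1, 1]"
  have "vanishing_order_ge 8 (sign_runs 1 (rev ks @ 2 # ks))"
    unfolding ks_def by code_simp
  from littlewood_polys_sign_runs[OF this] show ?thesis by (simp add: ks_def)
qed

theorem theorem7p1:
  shows "littlewood_polys (2 ^ 51) 52 \<noteq> {}"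
proof -
  note mult = littlewood_polys_mult and pow = littlewood_polys_power
  note p2 = littlewood_polys_2_1 and p48 = littlewood_polys_48_6
    and p144 = littlewood_polys_144_8 and p192 = littlewood_polys_192_9
    and p208 = littlewood_polys_208_8 and p224 = littlewood_polys_224_8
    and p272 = littlewood_polys_272_8
  \<comment> \<open>The orders of the factors add up to 52 in each of the four products: 16 + 36, 6
    + 8 + 8 + 27 + 3, 8 + 16 + 8 + 18 + 2 and 32 + 8 + 12. Only the last product is prime to
    3.\<close>
  have "littlewood_polys (144 ^ 2 * 192 ^ 4) 52 \<noteq> {}"
    using mult[OF pow[OF p144, of 2] pow[OF p192, of 4]] by simp
  moreover have "littlewood_polys (48 * 144 * 224 * 192 ^ 3 * 2 ^ 3) 52 \<noteq> {}"
    using mult[OF mult[OF mult[OF mult[OF p48 p144] p224] pow[OF p192, of 3]] pow[OF p2, of 3]]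
    by simp
  moreover have "littlewood_polys (208 * 224 ^ 2 * 272 * 192 ^ 2 * 2 ^ 2) 52 \<noteq> {}"
    using mult[OF mult[OF mult[OF mult[OF p208 pow[OF p224, of 2]] p272] pow[OF p192, of 2]]
        pow[OF p2, of 2]]
    by simp
  moreover have "littlewood_polys (208 ^ 4 * 224 * 2 ^ 12) 52 \<noteq> {}"
    using mult[OF mult[OF pow[OF p208, of 4] p224] pow[OF p2, of 12]] by simp
  \<comment> \<open>Divided by \<open>2^32\<close>, the four lengths are 6561, 20412, 97461 and
    399854, with sum 524288 = \<open>2^19\<close>.\<close>
  ultimately have "littlewood_polys
      (144 ^ 2 * 192 ^ 4 + 48 * 144 * 224 * 192 ^ 3 * 2 ^ 3 +
        208 * 224 ^ 2 * 272 * 192 ^ 2 * 2 ^ 2 + 208 ^ 4 * 224 * 2 ^ 12) 52 \<noteq> {}"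
    by (intro littlewood_polys_add)
  then show ?thesis by simp
qed

end
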